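(* Let $1\le p<q<\infty$ and $1\le r<\infty$. The canonical system $\{e_n\}_{n\in\mathbb Z}$, where $e_n(k)=1$ if $k=n$ and $e_n(k)=0$ otherwise, is a $1$-unconditional Schauder basis of $\ell^p_{q,r}(\mathbb Z)$. In particular, the partial sum projections $$P_N(x)=\sum_{|n|\le N}x(n)e_n$$ satisfy $\|P_N\|_{\mathcal L(\ell^p_{q,r})}\le1$ for all $N$.
   Context: For $j\in\mathbb N_0=\{0,1,2,\dots\}$ and $k\in\mathbb Z$ let $I(j,k)=[2^jk,2^j(k+1))\cap\mathbb Z$ (a discrete dyadic interval with $2^j$ elements). For a real sequence $x=(x(k))_{k\in\mathbb Z}$ put $$\|x\|_{\ell^p_{q,r}}=\Big(\sum_{j=0}^\infty\sum_{k\in\mathbb Z}(2^j)^{r(\frac1q-\frac1p)}\Big(\sum_{l\in I(j,k)}|x(l)|^p\Big)^{r/p}\Big)^{1/r},$$ and let $\ell^p_{q,r}(\mathbb Z)$ be the normed space of all $x\in\mathbb R^{\mathbb Z}$ with $\|x\|_{\ell^p_{q,r}}<\infty$. $\mathcal L(\ell^p_{q,r})$ denotes the bounded linear operators on $\ell^p_{q,r}(\mathbb Z)$ with the operator norm. *)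

theory Defs
  imports "HOL-Analysis.Analysis" "HOL-Library.Function_Algebras"
begin

text \<open>Pointwise scalar multiplication, so that \<open>int \<Rightarrow> real\<close> is a real vector space.\<close>

instantiation "fun" :: (type, real_vector) real_vector
begin

definition scaleR_fun :: "real \<Rightarrow> ('a \<Rightarrow> 'b) \<Rightarrow> 'a \<Rightarrow> 'b"
  where "scaleR_fun c f = (\<lambda>x. c *\<^sub>R f x)"

instance
  by standard (simp_all add: scaleR_fun_def fun_eq_iff scaleR_add_right scaleR_add_left)

end

section \<open>Bases and operators in a normed space with explicit carrier and norm\<close>

text \<open>The spaces below depend on real parameters, so a normed space is given by a carrier \<open>X\<close>
  inside an ambient real vector space and a function \<open>\<nu>\<close> whose values outside \<open>X\<close> are
  irrelevant.\<close>

definition normed_space_on :: "'a::real_vector set \<Rightarrow> ('a \<Rightarrow> real) \<Rightarrow> bool"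
  where "normed_space_on X \<nu> \<longleftrightarrow>
    subspace X \<and>
    (\<forall>x\<in>X. 0 \<le> \<nu> x) \<and>
    (\<forall>x\<in>X. \<nu> x = 0 \<longleftrightarrow> x = 0) \<and>
    (\<forall>c. \<forall>x\<in>X. \<nu> (c *\<^sub>R x) = \<bar>c\<bar> * \<nu> x) \<and>
    (\<forall>x\<in>X. \<forall>y\<in>X. \<nu> (x + y) \<le> \<nu> x + \<nu> y)"

definition schauder_basis :: "'a::real_vector set \<Rightarrow> ('a \<Rightarrow> real) \<Rightarrow> (nat \<Rightarrow> 'a) \<Rightarrow> bool"
  where "schauder_basis X \<nu> b \<longleftrightarrow>
    normed_space_on X \<nu> \<and>
    range b \<subseteq> X \<and>
    (\<forall>x\<in>X. \<exists>!a :: nat \<Rightarrow> real. (\<lambda>m. \<nu> (x - (\<Sum>i<m. a i *\<^sub>R b i))) \<longlonglongrightarrow> 0)"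

text \<open>The index set \<open>\<int>\<close> carries no preferred enumeration: the system must be a Schauder basis in
  every order, which is exactly unconditionality of the expansions. The last clause says that the
  unconditional basis constant is at most \<open>C\<close>; the choice \<open>a n = \<plusminus> c n\<close> gives the usual
  inequality for changes of signs.\<close>

definition unconditional_basis ::
    "real \<Rightarrow> 'a::real_vector set \<Rightarrow> ('a \<Rightarrow> real) \<Rightarrow> (int \<Rightarrow> 'a) \<Rightarrow> bool"
  where "unconditional_basis C X \<nu> b \<longleftrightarrow>
    (\<forall>\<sigma> :: nat \<Rightarrow> int. bij \<sigma> \<longrightarrow> schauder_basis X \<nu> (b \<circ> \<sigma>)) \<and>
    (\<forall>F a c. finite F \<longrightarrow> (\<forall>n\<in>F. \<bar>a n\<bar> \<le> \<bar>c n\<bar>) \<longrightarrow>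
      \<nu> (\<Sum>n\<in>F. a n *\<^sub>R b n) \<le> C * \<nu> (\<Sum>n\<in>F. c n *\<^sub>R b n))"

definition bounded_operator_on ::
    "'a::real_vector set \<Rightarrow> ('a \<Rightarrow> real) \<Rightarrow> ('a \<Rightarrow> 'a) \<Rightarrow> bool"
  where "bounded_operator_on X \<nu> T \<longleftrightarrow>
    T ` X \<subseteq> X \<and>
    (\<forall>x\<in>X. \<forall>y\<in>X. T (x + y) = T x + T y) \<and>
    (\<forall>c. \<forall>x\<in>X. T (c *\<^sub>R x) = c *\<^sub>R T x) \<and>
    (\<exists>K. \<forall>x\<in>X. \<nu> (T x) \<le> K * \<nu> x)"

text \<open>Meaningful for bounded operators only, where the supremum is over a bounded set.\<close>

definition operator_norm_on ::
    "'a::real_vector set \<Rightarrow> ('a \<Rightarrow> real) \<Rightarrow> ('a \<Rightarrow> 'a) \<Rightarrow> real"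
  where "operator_norm_on X \<nu> T = (SUP x\<in>{x\<in>X. \<nu> x \<le> 1}. \<nu> (T x))"

section \<open>The spaces $\ell^p_{q,r}(\mathbb{Z})$\<close>

definition dyadic_interval :: "nat \<Rightarrow> int \<Rightarrow> int set"
  where "dyadic_interval j k = {2 ^ j * k ..< 2 ^ j * (k + 1)}"

text \<open>The $r$-th power of the norm, with values in $[0,\infty]$; it is finite iff the norm is.\<close>

definition lpqr_sum :: "real \<Rightarrow> real \<Rightarrow> real \<Rightarrow> (int \<Rightarrow> real) \<Rightarrow> ennreal"
  where "lpqr_sum p q r x =
    (\<Sum>j. \<Sum>\<^sub>\<infinity>k\<in>UNIV. ennreal (
      (2 ^ j) powr (r * (1 / q - 1 / p)) *
      (\<Sum>l\<in>dyadic_interval j k. \<bar>x l\<bar> powr p) powr (r / p)))"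

definition lpqr_space :: "real \<Rightarrow> real \<Rightarrow> real \<Rightarrow> (int \<Rightarrow> real) set"
  where "lpqr_space p q r = {x. lpqr_sum p q r x < \<infinity>}"

definition lpqr_norm :: "real \<Rightarrow> real \<Rightarrow> real \<Rightarrow> (int \<Rightarrow> real) \<Rightarrow> real"
  where "lpqr_norm p q r x = enn2real (lpqr_sum p q r x) powr (1 / r)"

definition unit_seq :: "int \<Rightarrow> int \<Rightarrow> real"
  where "unit_seq n = (\<lambda>k. if k = n then 1 else 0)"

definition partial_sum_proj :: "nat \<Rightarrow> (int \<Rightarrow> real) \<Rightarrow> int \<Rightarrow> real"
  where "partial_sum_proj N x = (\<Sum>n\<in>{n. \<bar>n\<bar> \<le> int N}. x n *\<^sub>R unit_seq n)"

end

theory Submission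
  imports Defs
begin

text \<open>For a dyadic interval $I(j,k)$ the block norm
  $B_{jk}(x) = 2^{j(1/q-1/p)} (\sum_{l \in I(j,k)} |x(l)|^p)^{1/p}$ is a seminorm that depends on the
  absolute values $|x(l)|$ only and increases with each of them. The norm of $x$ is the $\ell^r$ norm
  of the family $(B_{jk}(x))$, that is, an $L^r$ norm for the counting measure on
  $\mathbb{N} \times \mathbb{Z}$ (\<open>lpqr_sum_eq_nn_integral\<close>). Three properties of this norm give the
  result.

  It is monotone in $|x|$ (\<open>lpqr_space_norm_mono\<close>). Since the canonical system expands a sequence
  coordinate by coordinate, this is already the unconditional constant $1$ and the bound on the
  partial sum projections.

  Each coordinate is bounded by the norm (\<open>abs_le_lpqr_norm\<close>), because the intervals of length one
  carry the weight $1$. Hence coefficients of an expansion are unique, and the norm is definite.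

  It is order continuous: if $|u_m| \le |x|$ with $x$ in the space and $u_m \to 0$ pointwise, then the
  norms of $u_m$ tend to $0$ (\<open>lpqr_norm_tendsto_zero\<close>). Every block is a finite sum, so all
  $B_{jk}(u_m)$ tend to $0$, and they are dominated by the $r$-summable family $(B_{jk}(x))$.
  Applied to the tails of $x$ along an arbitrary enumeration of $\mathbb{Z}$, this is the convergence
  of the expansion.

  The condition $p < q$ puts the unit vectors into the space (\<open>unit_seq_in_lpqr_space\<close>): at every
  level exactly one block contains a given integer, so the norm of a unit vector is governed by the geometric series with
  ratio $2^{r(1/q-1/p)}$. The triangle inequality is Minkowski's inequality, used for the finite sums
  inside the blocks and again for the sum over all blocks.\<close>

section \<open>Minkowski's inequality\<close>

lemma powr_convex_nonneg:
  fixes s t u v :: real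
  assumes "1 \<le> s" "0 \<le> t" "t \<le> 1" "0 \<le> u" "0 \<le> v"
  shows "((1 - t) * u + t * v) powr s \<le> (1 - t) * u powr s + t * v powr s"
proof -
  have scale: "(c * w) powr s \<le> c * w powr s" if "0 \<le> c" "c \<le> 1" "0 \<le> w" for c w :: real
    using that assms(1) powr_mono'[of 1 s c] by (simp add: powr_mult mult_right_mono)
  consider "u = 0" | "v = 0" | "0 < u" "0 < v"
    using assms by linarith
  then show ?thesis
  proof cases
    case 3
    then show ?thesis
      using convex_onD[OF powr_convex[OF assms(1)], of t u v] assms by simp
  qed (use scale[of t v] scale[of "1 - t" u] assms in auto)
qed

text \<open>The quotient $(f+g)/(a+b)$ is the convex combination of $f/a$ and $g/b$ with weights
  $a/(a+b)$ and $b/(a+b)$, so convexity of $u \mapsto u^s$ can be integrated. Stating the inequality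
  for balls of radius $a$ and $b$ avoids taking roots of extended reals, and it includes that the
  integral for $f+g$ is finite.\<close>

lemma nn_integral_Minkowski_pos:
  fixes f g :: "'a \<Rightarrow> real"
  assumes s: "1 \<le> s" and ab: "0 < a" "0 < b"
    and [measurable]: "f \<in> borel_measurable M" "g \<in> borel_measurable M"
    and nonneg: "\<And>x. 0 \<le> f x" "\<And>x. 0 \<le> g x"
    and f: "(\<integral>\<^sup>+x. ennreal (f x powr s) \<partial>M) \<le> ennreal (a powr s)"
    and g: "(\<integral>\<^sup>+x. ennreal (g x powr s) \<partial>M) \<le> ennreal (b powr s)"
  shows "(\<integral>\<^sup>+x. ennreal ((f x + g x) powr s) \<partial>M) \<le> ennreal ((a + b) powr s)"
proof -
  define t where "t = b / (a + b)"
  define c where "c = (a + b) powr s * (1 - t) / a powr s"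
  define d where "d = (a + b) powr s * t / b powr s"
  have t: "0 \<le> t" "t \<le> 1" "1 - t = a / (a + b)"
    using ab by (auto simp: t_def field_simps)
  have cd: "0 \<le> c" "0 \<le> d"
    using t(1,2) unfolding c_def d_def by (intro divide_nonneg_nonneg mult_nonneg_nonneg; simp)+
  have pw: "(f x + g x) powr s \<le> c * f x powr s + d * g x powr s" for x
  proof -
    have weights: "(a + b) * (1 - t) = a" "(a + b) * t = b"
      using ab by (auto simp: t(3)) (auto simp: t_def)
    have "(a + b) * ((1 - t) * (f x / a) + t * (g x / b))
        = ((a + b) * (1 - t)) * (f x / a) + ((a + b) * t) * (g x / b)"
      by (simp only: distrib_left mult.assoc)
    then have "f x + g x = (a + b) * ((1 - t) * (f x / a) + t * (g x / b))"
      unfolding weights using ab by simp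
    then have "(f x + g x) powr s = (a + b) powr s * ((1 - t) * (f x / a) + t * (g x / b)) powr s"
      using ab t nonneg[of x] by (simp add: powr_mult)
    also have "\<dots> \<le> (a + b) powr s * ((1 - t) * (f x / a) powr s + t * (g x / b) powr s)"
      using s t ab nonneg[of x] by (intro mult_left_mono powr_convex_nonneg) auto
    also have "\<dots> = c * f x powr s + d * g x powr s"
      using ab nonneg[of x] by (simp add: c_def d_def powr_divide algebra_simps)
    finally show ?thesis .
  qed
  have "(\<integral>\<^sup>+x. ennreal ((f x + g x) powr s) \<partial>M)
      \<le> (\<integral>\<^sup>+x. ennreal c * ennreal (f x powr s) + ennreal d * ennreal (g x powr s) \<partial>M)"
    using pw cd by (intro nn_integral_mono) (simp flip: ennreal_mult ennreal_plus)
  also have "\<dots> = ennreal c * (\<integral>\<^sup>+x. ennreal (f x powr s) \<partial>M)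
      + ennreal d * (\<integral>\<^sup>+x. ennreal (g x powr s) \<partial>M)"
    by (simp add: nn_integral_add nn_integral_cmult)
  also have "\<dots> \<le> ennreal c * ennreal (a powr s) + ennreal d * ennreal (b powr s)"
    by (intro add_mono mult_left_mono f g) auto
  also have "\<dots> = ennreal (c * a powr s + d * b powr s)"
    using cd by (simp flip: ennreal_mult ennreal_plus)
  also have "c * a powr s + d * b powr s = (a + b) powr s"
  proof -
    have "c * a powr s = (a + b) powr s * (1 - t)" "d * b powr s = (a + b) powr s * t"
      using ab by (simp_all add: c_def d_def)
    then show ?thesis
      by (simp add: algebra_simps)
  qed
  finally show ?thesis .
qed

text \<open>Radii that vanish are reached by enlarging both radii and letting the increment tend to $0$.\<close>

lemma nn_integral_Minkowski:
  fixes f g :: "'a \<Rightarrow> real"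
  assumes s: "1 \<le> s" and ab: "0 \<le> a" "0 \<le> b"
    and [measurable]: "f \<in> borel_measurable M" "g \<in> borel_measurable M"
    and nonneg: "\<And>x. 0 \<le> f x" "\<And>x. 0 \<le> g x"
    and f: "(\<integral>\<^sup>+x. ennreal (f x powr s) \<partial>M) \<le> ennreal (a powr s)"
    and g: "(\<integral>\<^sup>+x. ennreal (g x powr s) \<partial>M) \<le> ennreal (b powr s)"
  shows "(\<integral>\<^sup>+x. ennreal ((f x + g x) powr s) \<partial>M) \<le> ennreal ((a + b) powr s)"
proof (rule tendsto_lowerbound)
  have "((\<lambda>e. ((a + e) + (b + e)) powr s) \<longlongrightarrow> ((a + 0) + (b + 0)) powr s) (at_right 0)"
  proof (rule tendsto_powr2)
    show "((\<lambda>e. (a + e) + (b + e)) \<longlongrightarrow> (a + 0) + (b + 0)) (at_right 0)"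
      by (intro tendsto_intros)
    show "\<forall>\<^sub>F e in at_right 0. 0 \<le> (a + e) + (b + e)"
      using eventually_at_right_less[of 0] by eventually_elim (use ab in simp)
  qed (use s in auto)
  then show "((\<lambda>e. ennreal (((a + e) + (b + e)) powr s)) \<longlongrightarrow> ennreal ((a + b) powr s)) (at_right 0)"
    by (intro tendsto_ennrealI) simp
  have mono: "ennreal (c powr s) \<le> ennreal ((c + e) powr s)" if "0 \<le> c" "0 < e" for c e :: real
    using that s by (intro ennreal_leI powr_mono2) auto
  show "\<forall>\<^sub>F e in at_right 0. (\<integral>\<^sup>+x. ennreal ((f x + g x) powr s) \<partial>M)
      \<le> ennreal (((a + e) + (b + e)) powr s)"
    using eventually_at_right_less[of 0]
  proof eventually_elim
    case (elim e)
    then show ?case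
      using ab order_trans[OF f mono] order_trans[OF g mono]
      by (intro nn_integral_Minkowski_pos s nonneg) auto
  qed
qed simp

lemma sum_Minkowski:
  fixes f g :: "'a \<Rightarrow> real"
  assumes s: "1 \<le> s" and A: "finite A"
    and nonneg: "\<And>x. 0 \<le> f x" "\<And>x. 0 \<le> g x"
  shows "(\<Sum>x\<in>A. (f x + g x) powr s) powr (1 / s)
    \<le> (\<Sum>x\<in>A. f x powr s) powr (1 / s) + (\<Sum>x\<in>A. g x powr s) powr (1 / s)"
proof -
  have int: "(\<integral>\<^sup>+x. ennreal (h x powr s) \<partial>count_space A) = ennreal (\<Sum>x\<in>A. h x powr s)" for h
    using A by (simp add: nn_integral_count_space_finite)
  have root: "((\<Sum>x\<in>A. h x powr s) powr (1 / s)) powr s = (\<Sum>x\<in>A. h x powr s)" for h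
    using s by (simp add: powr_powr sum_nonneg)
  have "(\<integral>\<^sup>+x. ennreal ((f x + g x) powr s) \<partial>count_space A)
    \<le> ennreal (((\<Sum>x\<in>A. f x powr s) powr (1 / s) + (\<Sum>x\<in>A. g x powr s) powr (1 / s)) powr s)"
    by (intro nn_integral_Minkowski s nonneg) (auto simp: int root)
  then have "(\<Sum>x\<in>A. (f x + g x) powr s)
    \<le> ((\<Sum>x\<in>A. f x powr s) powr (1 / s) + (\<Sum>x\<in>A. g x powr s) powr (1 / s)) powr s"
    by (simp add: int)
  then have "(\<Sum>x\<in>A. (f x + g x) powr s) powr (1 / s)
    \<le> (((\<Sum>x\<in>A. f x powr s) powr (1 / s) + (\<Sum>x\<in>A. g x powr s) powr (1 / s)) powr s) powr (1 / s)"
    using s by (intro powr_mono2) (auto intro: sum_nonneg)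
  then show ?thesis
    using s by (simp add: powr_powr)
qed

section \<open>The norm as an integral over dyadic intervals\<close>

definition block_norm :: "real \<Rightarrow> real \<Rightarrow> (int \<Rightarrow> real) \<Rightarrow> nat \<times> int \<Rightarrow> real"
  where "block_norm p q x = (\<lambda>(j, k). (2 ^ j) powr (1 / q - 1 / p) *
    (\<Sum>l\<in>dyadic_interval j k. \<bar>x l\<bar> powr p) powr (1 / p))"

lemma block_norm_nonneg: "0 \<le> block_norm p q x jk"
  by (auto simp: block_norm_def split: prod.split)

lemma block_norm_mono:
  assumes "1 \<le> p" "\<And>l. \<bar>x l\<bar> \<le> \<bar>y l\<bar>"
  shows "block_norm p q x jk \<le> block_norm p q y jk"
  using assms unfolding block_norm_def
  by (auto split: prod.split intro!: mult_left_mono powr_mono2 sum_mono sum_nonneg)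

lemma block_norm_add:
  assumes "1 \<le> p"
  shows "block_norm p q (x + y) jk \<le> block_norm p q x jk + block_norm p q y jk"
proof -
  have "(\<Sum>l\<in>I. \<bar>x l + y l\<bar> powr p) powr (1 / p)
      \<le> (\<Sum>l\<in>I. \<bar>x l\<bar> powr p) powr (1 / p) + (\<Sum>l\<in>I. \<bar>y l\<bar> powr p) powr (1 / p)"
    if "finite I" for I
  proof -
    have "(\<Sum>l\<in>I. \<bar>x l + y l\<bar> powr p) powr (1 / p)
        \<le> (\<Sum>l\<in>I. (\<bar>x l\<bar> + \<bar>y l\<bar>) powr p) powr (1 / p)"
      using assms by (intro powr_mono2 sum_mono sum_nonneg) auto
    also have "\<dots> \<le> (\<Sum>l\<in>I. \<bar>x l\<bar> powr p) powr (1 / p) + (\<Sum>l\<in>I. \<bar>y l\<bar> powr p) powr (1 / p)"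
      by (intro sum_Minkowski assms that) auto
    finally show ?thesis .
  qed
  then show ?thesis
    unfolding block_norm_def
    by (auto split: prod.split simp: dyadic_interval_def simp flip: distrib_left intro!: mult_left_mono)
qed

lemma block_norm_scaleR:
  assumes "1 \<le> p"
  shows "block_norm p q (c *\<^sub>R x) jk = \<bar>c\<bar> * block_norm p q x jk"
  using assms unfolding block_norm_def
  by (auto split: prod.split simp: scaleR_fun_def abs_mult powr_mult sum_nonneg powr_powr
      simp flip: sum_distrib_left)

lemma block_norm_singleton: "1 \<le> p \<Longrightarrow> block_norm p q x (0, k) = \<bar>x k\<bar>"
proof -
  assume "1 \<le> p"
  moreover have "dyadic_interval 0 k = {k}"
    by (auto simp: dyadic_interval_def)
  ultimately show ?thesis
    by (simp add: block_norm_def powr_powr)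
qed

text \<open>Enumerating $\mathbb{Z}$ turns both sides into the same series over $\mathbb{N}$.\<close>

lemma infsum_int_eq_nn_integral:
  fixes f :: "int \<Rightarrow> ennreal"
  shows "(\<Sum>\<^sub>\<infinity>k. f k) = (\<integral>\<^sup>+k. f k \<partial>count_space UNIV)"
proof -
  have "(\<Sum>\<^sub>\<infinity>k. f k) = (\<Sum>\<^sub>\<infinity>n. f (int_decode n))"
    by (rule infsum_reindex_bij_betw[symmetric]) (rule bij_int_decode)
  also have "\<dots> = (\<Sum>n. f (int_decode n))"
    by (intro sums_unique has_sum_imp_sums has_sum_infsum nonneg_summable_on_complete) auto
  also have "\<dots> = (\<integral>\<^sup>+n. f (int_decode n) \<partial>count_space UNIV)"
    by (simp add: nn_integral_count_space_nat)
  also have "\<dots> = (\<integral>\<^sup>+k. f k \<partial>count_space UNIV)"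
    by (rule nn_integral_bij_count_space) (rule bij_int_decode)
  finally show ?thesis .
qed

lemma lpqr_sum_eq_nn_integral:
  assumes "1 \<le> p"
  shows "lpqr_sum p q r x = (\<integral>\<^sup>+jk. ennreal (block_norm p q x jk powr r) \<partial>count_space UNIV)"
proof -
  have "lpqr_sum p q r x = (\<integral>\<^sup>+j. \<integral>\<^sup>+k. ennreal (block_norm p q x (j, k) powr r)
      \<partial>count_space UNIV \<partial>count_space UNIV)"
    unfolding lpqr_sum_def infsum_int_eq_nn_integral nn_integral_count_space_nat[symmetric]
    by (simp add: block_norm_def powr_mult powr_powr sum_nonneg mult.commute)
  then show ?thesis
    using nn_integral_fst_count_space[of "\<lambda>jk. ennreal (block_norm p q x jk powr r)"] by simp
qed

text \<open>The real-valued norm says nothing about a sequence outside the space, since an infinite sum is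
  sent to $0$. Membership and norm bound are therefore encoded together, in the form that
  Minkowski's inequality produces.\<close>

lemma lpqr_sum_le_iff:
  assumes "1 \<le> r" "0 \<le> c"
  shows "lpqr_sum p q r x \<le> ennreal (c powr r) \<longleftrightarrow> x \<in> lpqr_space p q r \<and> lpqr_norm p q r x \<le> c"
    (is "?L \<longleftrightarrow> ?R")
proof -
  have root: "(d powr r) powr (1 / r) = d" "(d powr (1 / r)) powr r = d" if "0 \<le> d" for d :: real
    using that assms by (auto simp: powr_powr)
  show ?thesis
  proof (cases "lpqr_sum p q r x")
    case (real d)
    have "d \<le> c powr r \<longleftrightarrow> d powr (1 / r) \<le> c"
      using powr_mono2[of "1 / r" d "c powr r"] powr_mono2[of r "d powr (1 / r)" c] root real assms
      by auto
    then show ?thesis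
      using real by (simp add: lpqr_space_def lpqr_norm_def)
  next
    case top
    then show ?thesis
      by (simp add: lpqr_space_def top_unique)
  qed
qed

lemma lpqr_norm_nonneg: "0 \<le> lpqr_norm p q r x"
  by (simp add: lpqr_norm_def)

lemma lpqr_sum_eq_norm:
  assumes "1 \<le> r" "x \<in> lpqr_space p q r"
  shows "lpqr_sum p q r x = ennreal (lpqr_norm p q r x powr r)"
  using assms
  by (cases "lpqr_sum p q r x") (auto simp: lpqr_space_def lpqr_norm_def powr_powr)

lemma lpqr_space_norm_mono:
  assumes "1 \<le> p" "1 \<le> r" "y \<in> lpqr_space p q r" "\<And>l. \<bar>x l\<bar> \<le> \<bar>y l\<bar>"
  shows "x \<in> lpqr_space p q r \<and> lpqr_norm p q r x \<le> lpqr_norm p q r y"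
proof -
  have "lpqr_sum p q r x \<le> lpqr_sum p q r y"
    unfolding lpqr_sum_eq_nn_integral[OF assms(1)] using assms
    by (intro nn_integral_mono ennreal_leI powr_mono2 block_norm_mono block_norm_nonneg) auto
  then show ?thesis
    using lpqr_sum_le_iff[of r "lpqr_norm p q r y" p q x] lpqr_sum_eq_norm[of r y p q] assms
    by (simp add: lpqr_norm_nonneg)
qed

lemma lpqr_space_norm_add:
  assumes "1 \<le> p" "1 \<le> r" "x \<in> lpqr_space p q r" "y \<in> lpqr_space p q r"
  shows "x + y \<in> lpqr_space p q r \<and> lpqr_norm p q r (x + y) \<le> lpqr_norm p q r x + lpqr_norm p q r y"
proof -
  have "lpqr_sum p q r (x + y)
      \<le> (\<integral>\<^sup>+jk. ennreal ((block_norm p q x jk + block_norm p q y jk) powr r) \<partial>count_space UNIV)"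
    unfolding lpqr_sum_eq_nn_integral[OF assms(1)] using assms
    by (intro nn_integral_mono ennreal_leI powr_mono2 block_norm_add block_norm_nonneg) auto
  also have "\<dots> \<le> ennreal ((lpqr_norm p q r x + lpqr_norm p q r y) powr r)"
    using assms
    by (intro nn_integral_Minkowski)
       (auto simp: block_norm_nonneg lpqr_norm_nonneg lpqr_sum_eq_norm
         simp flip: lpqr_sum_eq_nn_integral)
  finally show ?thesis
    using assms by (subst (asm) lpqr_sum_le_iff) (auto simp: lpqr_norm_nonneg)
qed

lemma lpqr_space_norm_scaleR:
  assumes "1 \<le> p" "1 \<le> r" "x \<in> lpqr_space p q r"
  shows "c *\<^sub>R x \<in> lpqr_space p q r \<and> lpqr_norm p q r (c *\<^sub>R x) = \<bar>c\<bar> * lpqr_norm p q r x"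
proof -
  have "lpqr_sum p q r (c *\<^sub>R x) = ennreal (\<bar>c\<bar> powr r) * lpqr_sum p q r x"
    unfolding lpqr_sum_eq_nn_integral[OF assms(1)] using assms
    by (simp add: block_norm_scaleR powr_mult block_norm_nonneg ennreal_mult nn_integral_cmult)
  also have "\<dots> = ennreal ((\<bar>c\<bar> * lpqr_norm p q r x) powr r)"
    using assms by (simp add: lpqr_sum_eq_norm powr_mult lpqr_norm_nonneg ennreal_mult)
  finally have eq: "lpqr_sum p q r (c *\<^sub>R x) = ennreal ((\<bar>c\<bar> * lpqr_norm p q r x) powr r)" .
  then show ?thesis
    using assms
    by (auto simp: lpqr_space_def lpqr_norm_def[of p q r "c *\<^sub>R x"] powr_powr lpqr_norm_nonneg)
qed

text \<open>The block at level $0$ above $k$ is $|x(k)|$ itself, and it is one of the terms of the norm.\<close>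

lemma abs_le_lpqr_norm:
  assumes "1 \<le> p" "1 \<le> r" "x \<in> lpqr_space p q r"
  shows "\<bar>x k\<bar> \<le> lpqr_norm p q r x"
proof -
  have "ennreal (\<bar>x k\<bar> powr r) \<le> lpqr_sum p q r x"
    using nn_integral_ge_point[of "(0, k)" UNIV "\<lambda>jk. ennreal (block_norm p q x jk powr r)"] assms(1)
    by (simp add: block_norm_singleton lpqr_sum_eq_nn_integral)
  then have "\<bar>x k\<bar> powr r \<le> lpqr_norm p q r x powr r"
    using assms by (simp add: lpqr_sum_eq_norm)
  then show ?thesis
    using assms powr_less_mono2[of r "lpqr_norm p q r x" "\<bar>x k\<bar>"] lpqr_norm_nonneg[of p q r x]
    by fastforce
qed

lemma lpqr_normed_space:
  assumes "1 \<le> p" "1 \<le> r"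
  shows "normed_space_on (lpqr_space p q r) (lpqr_norm p q r)"
proof -
  have zero: "lpqr_sum p q r 0 = 0"
    unfolding lpqr_sum_eq_nn_integral[OF assms(1)] using assms
    by (auto simp: block_norm_def split: prod.split)
  then have "0 \<in> lpqr_space p q r" "lpqr_norm p q r 0 = 0"
    by (auto simp: lpqr_space_def lpqr_norm_def)
  moreover have "x = 0" if "x \<in> lpqr_space p q r" "lpqr_norm p q r x = 0" for x
    using abs_le_lpqr_norm[OF assms that(1)] that(2) by (auto simp: fun_eq_iff)
  ultimately show ?thesis
    using lpqr_space_norm_add[OF assms] lpqr_space_norm_scaleR[OF assms]
    unfolding normed_space_on_def subspace_def by (auto simp: lpqr_norm_nonneg)
qed

section \<open>The canonical system\<close>

lemma sum_scaleR_unit_seq: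
  assumes "finite A"
  shows "(\<Sum>n\<in>A. a n *\<^sub>R unit_seq n) = (\<lambda>k. if k \<in> A then a k else 0)"
  using assms
  by (induction A rule: finite_induct) (auto simp: fun_eq_iff scaleR_fun_def unit_seq_def)

text \<open>At level $j$ only the block with $k = \lfloor n/2^j \rfloor$ contains $n$, and it contributes
  $w^j$ with $w = 2^{r(1/q-1/p)}$. The series converges because $p < q$ makes $w < 1$.\<close>

lemma unit_seq_in_lpqr_space:
  assumes "1 \<le> p" "p < q" "1 \<le> r"
  shows "unit_seq n \<in> lpqr_space p q r"
proof -
  define w where "w = 2 powr (r * (1 / q - 1 / p))"
  have w: "0 \<le> w" "w < 1"
    using assms powr_less_mono[of "r * (1 / q - 1 / p)" 0 2]
    by (auto simp: w_def mult_less_0_iff field_simps)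
  have block: "block_norm p q (unit_seq n) (j, k) powr r = (if k = n div 2 ^ j then w ^ j else 0)"
    for j k
  proof -
    have mem: "n \<in> dyadic_interval j k \<longleftrightarrow> k = n div 2 ^ j"
    proof
      assume "n \<in> dyadic_interval j k"
      then show "k = n div 2 ^ j"
        by (intro sym[OF int_div_pos_eq[of _ _ _ "n - 2 ^ j * k"]])
           (auto simp: dyadic_interval_def algebra_simps)
    next
      assume k: "k = n div 2 ^ j"
      have "2 ^ j * (n div 2 ^ j) + n mod 2 ^ j = n" "0 \<le> n mod 2 ^ j" "n mod 2 ^ j < 2 ^ j"
        by auto
      then show "n \<in> dyadic_interval j k"
        unfolding dyadic_interval_def k atLeastLessThan_iff distrib_left mult_1_right by linarith
    qed
    have "(\<Sum>l\<in>dyadic_interval j k. \<bar>unit_seq n l\<bar> powr p) = (if n \<in> dyadic_interval j k then 1 else 0)"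
    proof -
      have "\<bar>unit_seq n l\<bar> powr p = (if l = n then 1 else 0)" for l
        by (simp add: unit_seq_def)
      then show ?thesis
        by (simp add: dyadic_interval_def)
    qed
    moreover have "((2 ^ j) powr (1 / q - 1 / p)) powr r = w ^ j"
      by (simp add: w_def powr_powr flip: powr_realpow) (simp add: algebra_simps)
    ultimately show ?thesis
      using mem by (auto simp: block_norm_def)
  qed
  have "lpqr_sum p q r (unit_seq n)
      = (\<integral>\<^sup>+j. \<integral>\<^sup>+k. ennreal (block_norm p q (unit_seq n) (j, k) powr r)
          \<partial>count_space UNIV \<partial>count_space UNIV)"
    using assms nn_integral_fst_count_space
      [of "\<lambda>jk. ennreal (block_norm p q (unit_seq n) jk powr r)"]
    by (simp add: lpqr_sum_eq_nn_integral)
  also have "\<dots> = (\<integral>\<^sup>+j. ennreal (w ^ j) \<partial>count_space UNIV)"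
  proof (intro nn_integral_cong)
    fix j :: nat
    show "(\<integral>\<^sup>+k. ennreal (block_norm p q (unit_seq n) (j, k) powr r) \<partial>count_space UNIV) = ennreal (w ^ j)"
      unfolding block by (subst nn_integral_count_space'[of "{n div 2 ^ j}"]) auto
  qed
  also have "\<dots> = ennreal (\<Sum>j. w ^ j)"
    using w by (simp add: nn_integral_count_space_nat suminf_ennreal2 summable_geometric)
  finally show ?thesis
    by (simp add: lpqr_space_def)
qed

text \<open>Dominated convergence over the set of blocks, with the family of $x$ as the majorant. Pointwise
  convergence of $u_m$ passes to each block because a block involves finitely many coordinates.\<close>

lemma lpqr_norm_tendsto_zero:
  assumes "1 \<le> p" "1 \<le> r" "x \<in> lpqr_space p q r"
    and le: "\<And>m l. \<bar>u m l\<bar> \<le> \<bar>x l\<bar>" and lim: "\<And>l. (\<lambda>m. u m l) \<longlonglongrightarrow> 0"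
  shows "(\<lambda>m. lpqr_norm p q r (u m)) \<longlonglongrightarrow> 0"
proof -
  have block: "(\<lambda>m. block_norm p q (u m) jk powr r) \<longlonglongrightarrow> 0" for jk
  proof -
    obtain j k where jk: "jk = (j, k)"
      by (cases jk)
    have "(\<lambda>m. \<bar>u m l\<bar> powr p) \<longlonglongrightarrow> 0" for l
      using assms lim[of l] by (intro tendsto_zero_powrI tendsto_rabs_zero) auto
    then have "(\<lambda>m. \<Sum>l\<in>dyadic_interval j k. \<bar>u m l\<bar> powr p) \<longlonglongrightarrow> 0"
      by (intro tendsto_null_sum) auto
    then have "(\<lambda>m. (\<Sum>l\<in>dyadic_interval j k. \<bar>u m l\<bar> powr p) powr (1 / p)) \<longlonglongrightarrow> 0"
      using assms by (intro tendsto_zero_powrI) (auto intro!: sum_nonneg always_eventually)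
    then have "(\<lambda>m. block_norm p q (u m) jk) \<longlonglongrightarrow> 0"
      unfolding block_norm_def jk by (simp add: tendsto_mult_right_zero)
    then show ?thesis
      using assms by (intro tendsto_zero_powrI) (auto simp: block_norm_nonneg)
  qed
  have "(\<lambda>m. \<integral>\<^sup>+jk. ennreal (block_norm p q (u m) jk powr r) \<partial>count_space UNIV)
      \<longlonglongrightarrow> (\<integral>\<^sup>+jk. ennreal 0 \<partial>count_space (UNIV :: (nat \<times> int) set))"
  proof (rule nn_integral_dominated_convergence
      [where w = "\<lambda>jk. ennreal (block_norm p q x jk powr r)"])
    show "AE jk in count_space UNIV. ennreal (block_norm p q (u m) jk powr r)
        \<le> ennreal (block_norm p q x jk powr r)" for m
      using assms by (intro AE_I2 ennreal_leI powr_mono2 block_norm_mono block_norm_nonneg) auto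
    show "(\<integral>\<^sup>+jk. ennreal (block_norm p q x jk powr r) \<partial>count_space UNIV) < \<infinity>"
      using assms by (simp add: lpqr_space_def flip: lpqr_sum_eq_nn_integral)
    show "AE jk in count_space UNIV. (\<lambda>m. ennreal (block_norm p q (u m) jk powr r)) \<longlonglongrightarrow> ennreal 0"
      by (intro AE_I2 tendsto_ennrealI block)
  qed auto
  then have "(\<lambda>m. lpqr_sum p q r (u m)) \<longlonglongrightarrow> ennreal 0"
    using assms by (simp add: lpqr_sum_eq_nn_integral)
  then have "(\<lambda>m. enn2real (lpqr_sum p q r (u m))) \<longlonglongrightarrow> 0"
    by (rule tendsto_enn2real) simp
  then show ?thesis
    unfolding lpqr_norm_def using assms by (intro tendsto_zero_powrI) auto
qed

text \<open>The remainder after $m$ terms is $x$ with the first $m$ enumerated coordinates deleted, so it is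
  dominated by $x$ and vanishes eventually at each coordinate; the enumeration does not matter.
  Conversely, if an expansion with coefficients $a$ converges to $x$, its coordinate at $\sigma(i)$
  equals $a_i$ from $m = i + 1$ on, while the error at that coordinate is bounded by the norm of
  the remainder.\<close>

lemma schauder_basis_unit_seq:
  assumes "1 \<le> p" "p < q" "1 \<le> r" and \<sigma>: "bij (\<sigma> :: nat \<Rightarrow> int)"
  shows "schauder_basis (lpqr_space p q r) (lpqr_norm p q r) (unit_seq \<circ> \<sigma>)"
proof -
  let ?X = "lpqr_space p q r" and ?\<nu> = "lpqr_norm p q r"
  have sub: "subspace ?X"
    using lpqr_normed_space[of p r q] assms by (simp add: normed_space_on_def)
  have inv: "inv \<sigma> (\<sigma> i) = i" "\<sigma> (inv \<sigma> k) = k" for i k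
    using \<sigma> by (auto simp: bij_def surj_f_inv_f)
  have mem: "k \<in> \<sigma> ` {..<m} \<longleftrightarrow> inv \<sigma> k < m" for k m
    using inv by (metis image_iff lessThan_iff)
  have sums: "(\<Sum>i<m. a i *\<^sub>R (unit_seq \<circ> \<sigma>) i) = (\<lambda>k. if inv \<sigma> k < m then a (inv \<sigma> k) else 0)"
    for a m
  proof -
    have "(\<Sum>i<m. a i *\<^sub>R (unit_seq \<circ> \<sigma>) i) = (\<Sum>n\<in>\<sigma> ` {..<m}. a (inv \<sigma> n) *\<^sub>R unit_seq n)"
      using \<sigma> by (subst sum.reindex) (auto simp: inv bij_def inj_on_def intro!: sum.cong)
    then show ?thesis
      by (simp add: sum_scaleR_unit_seq mem)
  qed
  have "\<exists>!a. (\<lambda>m. ?\<nu> (x - (\<Sum>i<m. a i *\<^sub>R (unit_seq \<circ> \<sigma>) i))) \<longlonglongrightarrow> 0" if x: "x \<in> ?X" for x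
  proof (rule ex1I[of _ "x \<circ> \<sigma>"])
    have tail: "x - (\<Sum>i<m. (x \<circ> \<sigma>) i *\<^sub>R (unit_seq \<circ> \<sigma>) i) = (\<lambda>k. if inv \<sigma> k < m then 0 else x k)" for m
      unfolding sums by (auto simp: fun_eq_iff inv)
    have "(\<lambda>m. if inv \<sigma> k < m then 0 else x k) \<longlonglongrightarrow> 0" for k
      by (rule tendsto_eventually) (use eventually_gt_at_top[of "inv \<sigma> k"] in eventually_elim, simp)
    then show "(\<lambda>m. ?\<nu> (x - (\<Sum>i<m. (x \<circ> \<sigma>) i *\<^sub>R (unit_seq \<circ> \<sigma>) i))) \<longlonglongrightarrow> 0"
      unfolding tail using assms x by (intro lpqr_norm_tendsto_zero[of p r x]) auto
  next
    fix a :: "nat \<Rightarrow> real"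
    assume lim: "(\<lambda>m. ?\<nu> (x - (\<Sum>i<m. a i *\<^sub>R (unit_seq \<circ> \<sigma>) i))) \<longlonglongrightarrow> 0"
    show "a = x \<circ> \<sigma>"
    proof
      fix i
      have in_X: "x - (\<Sum>i<m. a i *\<^sub>R (unit_seq \<circ> \<sigma>) i) \<in> ?X" for m
        using assms x sub
        by (intro subspace_diff subspace_sum subspace_scale) (auto simp: unit_seq_in_lpqr_space)
      have "\<forall>\<^sub>F m in sequentially. \<bar>x (\<sigma> i) - a i\<bar> \<le> ?\<nu> (x - (\<Sum>i<m. a i *\<^sub>R (unit_seq \<circ> \<sigma>) i))"
        using eventually_gt_at_top[of i]
      proof eventually_elim
        case (elim m)
        then show ?case
          using abs_le_lpqr_norm[OF assms(1,3) in_X[of m], of "\<sigma> i"]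
          unfolding sums by (simp add: inv)
      qed
      then have "\<bar>x (\<sigma> i) - a i\<bar> \<le> 0"
        by (intro tendsto_lowerbound[OF lim]) auto
      then show "a i = (x \<circ> \<sigma>) i"
        by simp
    qed
  qed
  then show ?thesis
    using assms lpqr_normed_space[of p r q] unit_seq_in_lpqr_space[of p q r]
    unfolding schauder_basis_def by auto
qed

lemma partial_sum_proj_apply: "partial_sum_proj N x k = (if \<bar>k\<bar> \<le> int N then x k else 0)"
proof -
  have "finite {n. \<bar>n\<bar> \<le> int N}"
    by (rule finite_subset[of _ "{- int N..int N}"]) auto
  then show ?thesis
    by (simp add: partial_sum_proj_def sum_scaleR_unit_seq)
qed

theorem proposition7p1:
  fixes p q r :: real
  assumes "1 \<le> p" and "p < q" and "1 \<le> r"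
  shows "unconditional_basis 1 (lpqr_space p q r) (lpqr_norm p q r) unit_seq \<and>
    (\<forall>N. bounded_operator_on (lpqr_space p q r) (lpqr_norm p q r) (partial_sum_proj N) \<and>
      operator_norm_on (lpqr_space p q r) (lpqr_norm p q r) (partial_sum_proj N) \<le> 1)"
proof (intro conjI allI)
  let ?X = "lpqr_space p q r" and ?\<nu> = "lpqr_norm p q r"
  have sub: "subspace ?X" and zero: "?\<nu> 0 = 0"
    using lpqr_normed_space[of p r q] assms
    by (auto simp: normed_space_on_def dest: subspace_0)
  have "?\<nu> (\<Sum>n\<in>F. a n *\<^sub>R unit_seq n) \<le> 1 * ?\<nu> (\<Sum>n\<in>F. c n *\<^sub>R unit_seq n)"
    if F: "finite F" and le: "\<forall>n\<in>F. \<bar>a n\<bar> \<le> \<bar>c n\<bar>" for F a c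
  proof -
    have "(\<Sum>n\<in>F. c n *\<^sub>R unit_seq n) \<in> ?X"
      using assms sub by (intro subspace_sum subspace_scale unit_seq_in_lpqr_space) auto
    then show ?thesis
      using lpqr_space_norm_mono[OF assms(1,3), of "\<Sum>n\<in>F. c n *\<^sub>R unit_seq n" q
          "\<Sum>n\<in>F. a n *\<^sub>R unit_seq n"] le
      by (simp add: sum_scaleR_unit_seq F)
  qed
  then show "unconditional_basis 1 ?X ?\<nu> unit_seq"
    using schauder_basis_unit_seq[OF assms] unfolding unconditional_basis_def by blast
  fix N
  have proj: "partial_sum_proj N x \<in> ?X \<and> ?\<nu> (partial_sum_proj N x) \<le> ?\<nu> x" if "x \<in> ?X" for x
    using assms that by (intro lpqr_space_norm_mono) (auto simp: partial_sum_proj_apply)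
  have "\<exists>K. \<forall>x\<in>?X. ?\<nu> (partial_sum_proj N x) \<le> K * ?\<nu> x"
    using proj by (intro exI[of _ 1]) auto
  then show "bounded_operator_on ?X ?\<nu> (partial_sum_proj N)"
    using proj unfolding bounded_operator_on_def
    by (auto simp: fun_eq_iff partial_sum_proj_apply scaleR_fun_def)
  show "operator_norm_on ?X ?\<nu> (partial_sum_proj N) \<le> 1"
    unfolding operator_norm_on_def
  proof (rule cSUP_least)
    show "{x \<in> ?X. ?\<nu> x \<le> 1} \<noteq> {}"
      using subspace_0[OF sub] zero by (intro ex_in_conv[THEN iffD1] exI[of _ 0]) simp
  qed (use proj in force)
qed

end
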